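(* Let $\mathbf{k}$ be a field of characteristic $0$ and let $(A,\mu,\alpha)$ be a Hom-algebra over $\mathbf{k}$. Then the following statements are equivalent. (1) $A$ is third Hom-power associative. (2) $as_A(x,x,x)=0$ for all $x\in A$. (3) $\sum_{\sigma\in S_3} as_A\circ\sigma=0$. (4) $[x\bullet y,\alpha(z)]+[z\bullet x,\alpha(y)]+[y\bullet z,\alpha(x)]=0$ for all $x,y,z\in A$. (5) The cyclic Hom-associator $S_A$ is totally anti-symmetric.
   Context: A Hom-algebra $(A,\mu,\alpha)$ over $\mathbf{k}$ is a $\mathbf{k}$-vector space $A$ with a bilinear map $\mu\colon A^{\otimes 2}\to A$ (no associativity assumed; write $xy=\mu(x,y)$) and a linear map $\alpha\colon A\to A$ (not assumed to be multiplicative). Third Hom-power associativity: with $x^1=x$, $x^2=xx$, $x^3=x^2\alpha(x)$, $A$ is third Hom-power associative if $x^3=\alpha^{2-i}(x^i)\,\alpha^{i-1}(x^{3-i})$ for all $x\in A$ and $i\in\{1,2\}$ (where $\alpha^0=Id$). Notation: $as_A(x,y,z)=(xy)\alpha(z)-\alpha(x)(yz)$ (Hom-associator); $S_A(x,y,z)=as_A(x,y,z)+as_A(z,x,y)+as_A(y,z,x)$ (cyclic Hom-associator); $x\bullet y=xy+yx$; $[x,y]=xy-yx$. The symmetric group $S_3$ acts on $A^{\otimes 3}$ by permuting the tensor factors. A multilinear map $f\colon A^{\otimes n}\to A$ is totally anti-symmetric if $f=(-1)^{\varepsilon(\sigma)}f\circ\sigma$ for all $\sigma\in S_n$, where $(-1)^{\varepsilon(\sigma)}$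 is the sign of $\sigma$. *)

theory Defs
  imports Complex_Main "HOL-Combinatorics.Permutations"
begin

(* The twisting map alpha is only required to be linear, not multiplicative. *)
locale hom_algebra = vector_space scale
  for scale :: "'k::field \<Rightarrow> 'a::ab_group_add \<Rightarrow> 'a" +
  fixes \<mu> :: "'a \<Rightarrow> 'a \<Rightarrow> 'a"
    and \<alpha> :: "'a \<Rightarrow> 'a"
  assumes linear_mult_right: "\<And>x. Vector_Spaces.linear scale scale (\<lambda>y. \<mu> x y)"
    and linear_mult_left: "\<And>y. Vector_Spaces.linear scale scale (\<lambda>x. \<mu> x y)"
    and linear_twist: "Vector_Spaces.linear scale scale \<alpha>"

(* Hom-powers are indexed from 1: x^1 = x and x^(n+2) = x^(n+1) alpha^n(x), so that
   x^2 = x x and x^3 = x^2 alpha(x).  The 0-th power is left unspecified. *)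
fun hom_power :: "('a \<Rightarrow> 'a \<Rightarrow> 'a) \<Rightarrow> ('a \<Rightarrow> 'a) \<Rightarrow> 'a \<Rightarrow> nat \<Rightarrow> 'a" where
  "hom_power \<mu> \<alpha> x (Suc 0) = x"
| "hom_power \<mu> \<alpha> x (Suc (Suc n)) = \<mu> (hom_power \<mu> \<alpha> x (Suc n)) ((\<alpha> ^^ n) x)"

definition third_hom_power_associative ::
    "('a \<Rightarrow> 'a \<Rightarrow> 'a) \<Rightarrow> ('a \<Rightarrow> 'a) \<Rightarrow> bool" where
  "third_hom_power_associative \<mu> \<alpha> \<longleftrightarrow>
    (\<forall>x. \<forall>i\<in>{1, 2}. hom_power \<mu> \<alpha> x 3 =
      \<mu> ((\<alpha> ^^ (2 - i)) (hom_power \<mu> \<alpha> x i)) ((\<alpha> ^^ (i - 1)) (hom_power \<mu> \<alpha> x (3 - i))))"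

definition hom_associator ::
    "('a::ab_group_add \<Rightarrow> 'a \<Rightarrow> 'a) \<Rightarrow> ('a \<Rightarrow> 'a) \<Rightarrow> 'a \<Rightarrow> 'a \<Rightarrow> 'a \<Rightarrow> 'a" where
  "hom_associator \<mu> \<alpha> x y z = \<mu> (\<mu> x y) (\<alpha> z) - \<mu> (\<alpha> x) (\<mu> y z)"

definition cyclic_hom_associator ::
    "('a::ab_group_add \<Rightarrow> 'a \<Rightarrow> 'a) \<Rightarrow> ('a \<Rightarrow> 'a) \<Rightarrow> 'a \<Rightarrow> 'a \<Rightarrow> 'a \<Rightarrow> 'a" where
  "cyclic_hom_associator \<mu> \<alpha> x y z =
    hom_associator \<mu> \<alpha> x y z + hom_associator \<mu> \<alpha> z x y + hom_associator \<mu> \<alpha> y z x"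

definition anticommutator :: "('a::ab_group_add \<Rightarrow> 'a \<Rightarrow> 'a) \<Rightarrow> 'a \<Rightarrow> 'a \<Rightarrow> 'a" where
  "anticommutator \<mu> x y = \<mu> x y + \<mu> y x"

definition commutator :: "('a::ab_group_add \<Rightarrow> 'a \<Rightarrow> 'a) \<Rightarrow> 'a \<Rightarrow> 'a \<Rightarrow> 'a" where
  "commutator \<mu> x y = \<mu> x y - \<mu> y x"

(* A map from the n-th tensor power of A is represented by the corresponding function of
   n-tuples.  A tuple (x_1, ..., x_n) is a function x on nat of which only the values at
   1, ..., n matter; a permutation s of {1..n} sends it to (x_(s 1), ..., x_(s n)). *)
definition permute_args :: "(nat \<Rightarrow> nat) \<Rightarrow> (nat \<Rightarrow> 'a) \<Rightarrow> (nat \<Rightarrow> 'a)" where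
  "permute_args \<sigma> x = (\<lambda>i. x (\<sigma> i))"

definition on_triples :: "('a \<Rightarrow> 'a \<Rightarrow> 'a \<Rightarrow> 'a) \<Rightarrow> (nat \<Rightarrow> 'a) \<Rightarrow> 'a" where
  "on_triples f x = f (x 1) (x 2) (x 3)"

definition totally_antisymmetric ::
    "('k::field \<Rightarrow> 'a::ab_group_add \<Rightarrow> 'a) \<Rightarrow> nat \<Rightarrow> ((nat \<Rightarrow> 'a) \<Rightarrow> 'a) \<Rightarrow> bool" where
  "totally_antisymmetric scale n f \<longleftrightarrow>
    (\<forall>\<sigma>. \<sigma> permutes {1..n} \<longrightarrow>
      f = (\<lambda>x. scale (of_int (sign \<sigma>)) ((f \<circ> permute_args \<sigma>) x)))"

end

theory Submission
  imports Defs
begin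

text \<open>
  The hub of all the equivalences is the symmetrization \<open>T(x,y,z)\<close> of the Hom-associator,
  the sum of its values over the six orders of \<open>x, y, z\<close>.

  \<^item> Condition (3) says \<open>T = 0\<close>. Grouping the six terms by cyclic order gives
    \<open>T(x,y,z) = S(x,y,z) + S(y,x,z)\<close>, with \<open>S\<close> the cyclic Hom-associator.
  \<^item> (2) and (3) are the cubic form \<open>as(x,x,x)\<close> and its polarization. Inclusion-exclusion over
    the sums of subsets of \<open>{x, y, z}\<close> recovers \<open>T\<close> from the cubic form by additivity alone,
    while \<open>T(x,x,x) = 6 as(x,x,x)\<close>, so the way back divides by 6
    (\<open>cyclic_hom_associator_polarization\<close>, \<open>hom_associator_diagonal_zero_iff\<close>).
  \<^item> (4) is \<open>T = 0\<close> once the commutators and anticommutators are expanded.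
  \<^item> (5) need only be tested on transpositions, as they generate the symmetric group
    (\<open>totally_antisymmetric_iff_transpose\<close>). Since \<open>S\<close> is invariant under cyclic shifts, all three
    transpositions give the same condition \<open>S(y,x,z) = - S(x,y,z)\<close>, that is \<open>T = 0\<close>.

  Finally (1) is (2) by unfolding the powers: its case \<open>i = 2\<close> is the definition of \<open>x\<^sup>3\<close>.
\<close>

lemma atLeastAtMost_1_3: "{1..3::nat} = insert 1 (insert 2 (insert 3 {}))"
  by auto

lemma sum_permutes_on_triples:
  fixes f :: "'a::ab_group_add \<Rightarrow> 'a \<Rightarrow> 'a \<Rightarrow> 'a"
  shows "(\<Sum>\<sigma> | \<sigma> permutes {1..3::nat}. (on_triples f \<circ> permute_args \<sigma>) x) =
    f (x 1) (x 2) (x 3) + f (x 3) (x 1) (x 2) + f (x 2) (x 3) (x 1) +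
    (f (x 2) (x 1) (x 3) + f (x 3) (x 2) (x 1) + f (x 1) (x 3) (x 2))"
  unfolding atLeastAtMost_1_3
  by (simp add: sum_over_permutations_insert on_triples_def permute_args_def transpose_def
      algebra_simps)

text \<open>
  Tuples enter the conditions on symmetrizations as functions on \<open>nat\<close>; every triple is the
  restriction of such a function to \<open>1, 2, 3\<close>.
\<close>

lemma all_tuples_iff_all_triples:
  "(\<forall>x::nat \<Rightarrow> 'a. P (x 1) (x 2) (x 3)) \<longleftrightarrow> (\<forall>a b c. P a b c)"
proof
  assume *: "\<forall>x::nat \<Rightarrow> 'a. P (x 1) (x 2) (x 3)"
  show "\<forall>a b c. P a b c"
  proof (intro allI)
    fix a b c
    from *[THEN spec, of "\<lambda>i. if i = 1 then a else if i = 2 then b else c"] show "P a b c"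
      by simp
  qed
qed blast

text \<open>
  Both composition with a permutation and its sign are multiplicative, so a sign rule for
  generators of the symmetric group propagates to the whole group.
\<close>

lemma totally_antisymmetric_iff_transpose:
  assumes "vector_space scale"
  shows "totally_antisymmetric scale n f \<longleftrightarrow>
    (\<forall>a\<in>{1..n}. \<forall>b\<in>{1..n}. a \<noteq> b \<longrightarrow> (\<forall>x. f (permute_args (transpose a b) x) = - f x))"
    (is "_ \<longleftrightarrow> ?transp")
proof
  interpret vector_space scale by fact
  assume anti: "totally_antisymmetric scale n f"
  show ?transp
  proof (intro ballI impI allI)
    fix a b x
    assume "a \<in> {1..n}" "b \<in> {1..n}" "a \<noteq> b"
    have "transpose a b permutes {1..n}"
      using \<open>a \<in> {1..n}\<close> \<open>b \<in> {1..n}\<close> by (rule permutes_swap_id)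
    from anti[unfolded totally_antisymmetric_def, rule_format, OF this, THEN fun_cong, of x]
    have "f x = - f (permute_args (transpose a b) x)"
      using \<open>a \<noteq> b\<close> by (simp add: sign_swap_id)
    then show "f (permute_args (transpose a b) x) = - f x" by simp
  qed
next
  interpret vector_space scale by fact
  assume transp: ?transp
  have "f x = scale (of_int (sign \<sigma>)) (f (permute_args \<sigma> x))" if "\<sigma> permutes {1..n}" for \<sigma> x
    using that finite_atLeastAtMost
  proof (induction arbitrary: x rule: permutes_induct)
    case id
    then show ?case by (simp add: permute_args_def)
  next
    case (swap a b p)
    have "permute_args (transpose a b \<circ> p) x = permute_args p (permute_args (transpose a b) x)"
      by (simp add: permute_args_def)
    moreover have "sign (transpose a b \<circ> p) = - sign p"
      using swap.hyps permutes_imp_permutation[of "{1..n}" p]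
      by (simp add: sign_compose sign_swap_id permutation_swap_id)
    moreover have "f x = - f (permute_args (transpose a b) x)"
      using transp swap.hyps by simp
    ultimately show ?case
      using swap.IH[of "permute_args (transpose a b) x"]
      by (simp only: of_int_minus scale_minus_left)
  qed
  then show "totally_antisymmetric scale n f"
    unfolding totally_antisymmetric_def comp_def by blast
qed

text \<open>
  The transpositions of \<open>{1..3}\<close> are conjugate under the 3-cycle that fixes \<open>f\<close>, so their sign
  rules are one and the same.
\<close>

lemma totally_antisymmetric_cyclic_iff:
  fixes f :: "'a::ab_group_add \<Rightarrow> 'a \<Rightarrow> 'a \<Rightarrow> 'a"
  assumes "vector_space scale" and cyclic: "\<And>x y z. f z x y = f x y z"
  shows "totally_antisymmetric scale 3 (on_triples f) \<longleftrightarrow> (\<forall>x y z. f x y z + f y x z = 0)"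
proof -
  have "totally_antisymmetric scale 3 (on_triples f) \<longleftrightarrow>
      (\<forall>x::nat \<Rightarrow> 'a. f (x 2) (x 1) (x 3) = - f (x 1) (x 2) (x 3) \<and>
           f (x 3) (x 2) (x 1) = - f (x 1) (x 2) (x 3) \<and>
           f (x 1) (x 3) (x 2) = - f (x 1) (x 2) (x 3))"
    unfolding totally_antisymmetric_iff_transpose[OF assms(1)] atLeastAtMost_1_3
    by (simp add: on_triples_def permute_args_def transpose_def del: One_nat_def) blast
  also have "\<dots> \<longleftrightarrow> (\<forall>x y z. f y x z = - f x y z \<and> f z y x = - f x y z \<and> f x z y = - f x y z)"
    by (rule all_tuples_iff_all_triples)
  also have "\<dots> \<longleftrightarrow> (\<forall>x y z. f y x z = - f x y z)"
    by (metis cyclic)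
  finally show ?thesis
    by (simp add: eq_neg_iff_add_eq_0 add.commute)
qed

lemma third_hom_power_associative_iff:
  "third_hom_power_associative \<mu> \<alpha> \<longleftrightarrow> (\<forall>x. hom_associator \<mu> \<alpha> x x x = 0)"
  by (simp add: third_hom_power_associative_def hom_associator_def numeral_eq_Suc)

lemma cyclic_hom_associator_rotate:
  "cyclic_hom_associator \<mu> \<alpha> z x y = cyclic_hom_associator \<mu> \<alpha> x y z"
  by (simp add: cyclic_hom_associator_def add_ac)

context hom_algebra
begin

lemma mult_add_left: "\<mu> (x + x') y = \<mu> x y + \<mu> x' y"
  by (rule module_hom.add[OF linear_mult_left[folded module_hom_iff_linear]])

lemma mult_add_right: "\<mu> x (y + y') = \<mu> x y + \<mu> x y'"
  by (rule module_hom.add[OF linear_mult_right[folded module_hom_iff_linear]])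

lemma twist_add: "\<alpha> (x + y) = \<alpha> x + \<alpha> y"
  by (rule module_hom.add[OF linear_twist[folded module_hom_iff_linear]])

lemma hom_associator_add:
  "hom_associator \<mu> \<alpha> (x + x') y z = hom_associator \<mu> \<alpha> x y z + hom_associator \<mu> \<alpha> x' y z"
  "hom_associator \<mu> \<alpha> x (y + y') z = hom_associator \<mu> \<alpha> x y z + hom_associator \<mu> \<alpha> x y' z"
  "hom_associator \<mu> \<alpha> x y (z + z') = hom_associator \<mu> \<alpha> x y z + hom_associator \<mu> \<alpha> x y z'"
  by (simp_all add: hom_associator_def mult_add_left mult_add_right twist_add)

text \<open>
  The polarization identity: inclusion-exclusion removes from the cubic form at \<open>x + y + z\<close>
  every term that misses one of the three summands.
\<close>

lemma cyclic_hom_associator_polarization: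
  fixes q
  defines "q \<equiv> \<lambda>x. hom_associator \<mu> \<alpha> x x x"
  shows "cyclic_hom_associator \<mu> \<alpha> x y z + cyclic_hom_associator \<mu> \<alpha> y x z =
    q (x + y + z) - q (x + y) - q (y + z) - q (x + z) + q x + q y + q z"
  unfolding q_def cyclic_hom_associator_def by (simp add: hom_associator_add)

text \<open>
  Polarization gives one direction. Conversely, on the diagonal the symmetrization is six times
  the cubic form, and the 6 can be cancelled.
\<close>

lemma hom_associator_diagonal_zero_iff:
  assumes "(6::'k) \<noteq> 0"
  shows "(\<forall>x. hom_associator \<mu> \<alpha> x x x = 0) \<longleftrightarrow>
    (\<forall>x y z. cyclic_hom_associator \<mu> \<alpha> x y z + cyclic_hom_associator \<mu> \<alpha> y x z = 0)"
proof (intro iffI allI)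
  fix x y z
  assume "\<forall>x. hom_associator \<mu> \<alpha> x x x = 0"
  then show "cyclic_hom_associator \<mu> \<alpha> x y z + cyclic_hom_associator \<mu> \<alpha> y x z = 0"
    unfolding cyclic_hom_associator_polarization by simp
next
  fix x
  let ?c = "hom_associator \<mu> \<alpha> x x x"
  assume "\<forall>x y z. cyclic_hom_associator \<mu> \<alpha> x y z + cyclic_hom_associator \<mu> \<alpha> y x z = 0"
  then have "cyclic_hom_associator \<mu> \<alpha> x x x + cyclic_hom_associator \<mu> \<alpha> x x x = 0"
    by blast
  then have "?c + ?c + ?c + (?c + ?c + ?c) = 0"
    unfolding cyclic_hom_associator_def .
  moreover have "scale 6 ?c = scale (1 + 1 + 1 + (1 + 1 + 1)) ?c"
    by simp
  ultimately have "scale 6 ?c = 0"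
    by (simp only: scale_left_distrib scale_one)
  then show "?c = 0"
    using assms by simp
qed

lemma sum_commutator_anticommutator:
  "commutator \<mu> (anticommutator \<mu> x y) (\<alpha> z)
    + commutator \<mu> (anticommutator \<mu> z x) (\<alpha> y)
    + commutator \<mu> (anticommutator \<mu> y z) (\<alpha> x)
    = cyclic_hom_associator \<mu> \<alpha> x y z + cyclic_hom_associator \<mu> \<alpha> y x z"
  by (simp add: commutator_def anticommutator_def cyclic_hom_associator_def hom_associator_def
      mult_add_left mult_add_right)

end

theorem theorem3p2:
  fixes scale :: "'k::field_char_0 \<Rightarrow> 'a::ab_group_add \<Rightarrow> 'a"
    and \<mu> :: "'a \<Rightarrow> 'a \<Rightarrow> 'a"
    and \<alpha> :: "'a \<Rightarrow> 'a"
  assumes "hom_algebra scale \<mu> \<alpha>"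
  shows "(third_hom_power_associative \<mu> \<alpha> \<longleftrightarrow>
            (\<forall>x. hom_associator \<mu> \<alpha> x x x = 0))
       \<and> ((\<forall>x. hom_associator \<mu> \<alpha> x x x = 0) \<longleftrightarrow>
            (\<forall>x. (\<Sum>\<sigma> | \<sigma> permutes {1..3::nat}.
                  (on_triples (hom_associator \<mu> \<alpha>) \<circ> permute_args \<sigma>) x) = 0))
       \<and> ((\<forall>x. (\<Sum>\<sigma> | \<sigma> permutes {1..3::nat}.
                  (on_triples (hom_associator \<mu> \<alpha>) \<circ> permute_args \<sigma>) x) = 0) \<longleftrightarrow>
            (\<forall>x y z. commutator \<mu> (anticommutator \<mu> x y) (\<alpha> z)
                    + commutator \<mu> (anticommutator \<mu> z x) (\<alpha> y)
                    + commutator \<mu> (anticommutator \<mu> y z) (\<alpha> x) = 0))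
       \<and> ((\<forall>x y z. commutator \<mu> (anticommutator \<mu> x y) (\<alpha> z)
                    + commutator \<mu> (anticommutator \<mu> z x) (\<alpha> y)
                    + commutator \<mu> (anticommutator \<mu> y z) (\<alpha> x) = 0) \<longleftrightarrow>
            totally_antisymmetric scale 3 (on_triples (cyclic_hom_associator \<mu> \<alpha>)))"
proof -
  interpret hom_algebra scale \<mu> \<alpha> by fact
  let ?T = "\<lambda>x y z. cyclic_hom_associator \<mu> \<alpha> x y z + cyclic_hom_associator \<mu> \<alpha> y x z"
  have "(\<Sum>\<sigma> | \<sigma> permutes {1..3::nat}.
      (on_triples (hom_associator \<mu> \<alpha>) \<circ> permute_args \<sigma>) x) = ?T (x 1) (x 2) (x 3)" for x
    unfolding sum_permutes_on_triples cyclic_hom_associator_def ..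
  then have symmetrization: "(\<forall>x. (\<Sum>\<sigma> | \<sigma> permutes {1..3::nat}.
      (on_triples (hom_associator \<mu> \<alpha>) \<circ> permute_args \<sigma>) x) = 0) \<longleftrightarrow> (\<forall>x y z. ?T x y z = 0)"
    using all_tuples_iff_all_triples[of "\<lambda>x y z. ?T x y z = 0"] by simp
  have antisymmetry: "totally_antisymmetric scale 3 (on_triples (cyclic_hom_associator \<mu> \<alpha>)) \<longleftrightarrow>
      (\<forall>x y z. ?T x y z = 0)"
    by (intro totally_antisymmetric_cyclic_iff vector_space_axioms cyclic_hom_associator_rotate)
  have diagonal: "(\<forall>x. hom_associator \<mu> \<alpha> x x x = 0) \<longleftrightarrow> (\<forall>x y z. ?T x y z = 0)"
    by (rule hom_associator_diagonal_zero_iff) simp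
  show ?thesis
    unfolding third_hom_power_associative_iff symmetrization antisymmetry diagonal
      sum_commutator_anticommutator
    by blast
qed

end
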